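(* Let $\alpha\in(\frac13,\frac12]$ (so $N=\lfloor1/\alpha\rfloor=2$), let $\mathbf X$ be an $\alpha$-Hölder planarly branched rough path over $A=\{1,\dots,d\}$ above $X=(X^1,\dots,X^d):[0,T]\to\mathbb R^d$, and let $F:\mathbb R^d\to\mathbb R^n$ be a smooth function. Define $\mathbf Z:[0,T]\to(\mathbb R\mathcal F^{\le1})^n$ by $$\langle\mathbf 1,\mathbf Z_t\rangle:=F(X_t),\qquad\langle\bullet_i,\mathbf Z_t\rangle:=\partial_iF(X_t),\qquad i\in A.$$ Then $\mathbf Z$ is an $\mathbf X$-controlled planarly branched rough path above $F(X)$.
   Context: Forests. $\mathcal F$ is the set of $A$-decorated planar rooted forests, i.e. finite ordered (possibly empty) sequences of planar rooted trees with vertices decorated by $A=\{1,\dots,d\}$; concatenation is written as juxtaposition, $\mathbf 1$ is the empty forest, $|\tau|$ is the number of vertices, and $\mathcal F^{\le m}=\{\tau\in\mathcal F:|\tau|\le m\}$. For $\tau\in\mathcal F$ and $i\in A$, $[\tau]_i$ is the tree obtained by joining the roots of the trees of $\tau$ (in the same left-to-right order) to a new root decorated by $i$; $\bullet_i=[\mathbf 1]_i$. Munthe-Kaas–Wright (MKW) Hopf algebra: $\mathbb R\mathcal F$ with the shuffle product ⧢ (forests viewed as words whose letters are trees) and the coproduct $\Delta$ given recursively by $\Delta(\mathbf 1)=\mathbf 1\otimes\mathbf 1$ and $\Delta(\omega[\tau]_i)=\omega[\tau]_i\otimes\mathbf 1+\Delta(\omega)\cdot(\mathrm{id}\otimes[\,\cdot\,]_i)\Delta(\tau)$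 for $\omega,\tau\in\mathcal F$, where $\cdot$ shuffles left tensor factors and concatenates right tensor factors (left admissible cuts). The pairing is $\langle\tau,\tau'\rangle=\delta_{\tau,\tau'}$ on forests and $\star$ is the dual product: $\langle x\star y,\tau\rangle=\langle x\otimes y,\Delta\tau\rangle$. Everything is truncated at $\mathbb R\mathcal F^{\le N}$. Planarly branched rough path. Let $\alpha\in(0,1]$, $N=\lfloor1/\alpha\rfloor$. An $\alpha$-Hölder planarly branched rough path is a map $\mathbf X:[0,T]^2\to\mathbb R\mathcal F^{\le N}$ with $\langle\mathbf X_{s,t},\mathbf 1\rangle=1$ such that (1) $\mathbf X_{s,u}\star\mathbf X_{u,t}=\mathbf X_{s,t}$ in the algebra truncated at $N$; (2) $\langle\mathbf X_{s,t},\sigma ⧢ \tau\rangle=\langle\mathbf X_{s,t},\sigma\rangle\langle\mathbf X_{s,t},\tau\rangle$ whenever $|\sigma|+|\tau|\le N$; (3) $\sup_{s\ne t}|\langle\mathbf X_{s,t},\tau\rangle|/|t-s|^{|\tau|\alpha}<\infty$ for all $\tau\in\mathcal F^{\le N}$. It is above $X=(X^1,\dots,X^d)$ if $\langle\mathbf X_{s,t},\bullet_i\rangle=X^i_t-X^i_s$ for all $i$. Controlled path. A map $\mathbf Y:[0,T]\to(\mathbb R\mathcal F^{\le N-1})^n$ (so $\langle\tau,\mathbf Y_t\rangle\in\mathbb R^n$) is an $\mathbf X$-controlled planarly branched rough path above $Y=\langle\mathbf 1,\mathbf Y\rangle$ if $|\langle\tau,\mathbf Y_t\rangle-\langle\mathbf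 X_{s,t}\star\tau,\mathbf Y_s\rangle|=O(|t-s|^{(N-|\tau|)\alpha})$ uniformly in $s,t$, for all $\tau\in\mathcal F^{\le N-1}$. *)

theory Defs
  imports "HOL-Analysis.Analysis" "HOL-Analysis.Finite_Function_Topology"
begin

section \<open>Decorated planar forests\<close>

text \<open>
  The alphabet \<open>A = {1,\<dots>,d}\<close> is a finite type \<open>'a\<close> with \<open>d = CARD('a)\<close>.  The tree
  \<open>[\<tau>]\<^sub>i\<close> is \<open>Node i \<tau>\<close>; a forest is the list of its trees, the empty forest is \<open>[]\<close>.
\<close>

datatype 'a ptree = Node 'a "'a ptree list"

type_synonym 'a forest = "'a ptree list"

abbreviation bullet :: "'a \<Rightarrow> 'a forest" where
  "bullet i \<equiv> [Node i []]"

primrec tree_size :: "'a ptree \<Rightarrow> nat" where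
  "tree_size (Node i ts) = Suc (sum_list (map tree_size ts))"

definition forest_size :: "'a forest \<Rightarrow> nat" where
  "forest_size \<tau> = sum_list (map tree_size \<tau>)"

definition forests_upto :: "nat \<Rightarrow> 'a forest set" where
  "forests_upto m = {\<tau>. forest_size \<tau> \<le> m}"

lemma forest_size_simps [simp]:
  "forest_size [] = 0"
  "forest_size (t # \<tau>) = tree_size t + forest_size \<tau>"
  "forest_size (\<sigma> @ \<tau>) = forest_size \<sigma> + forest_size \<tau>"
  by (simp_all add: forest_size_def)

lemma tree_size_Node [simp]: "tree_size (Node i \<tau>) = Suc (forest_size \<tau>)"
  by (simp add: forest_size_def)

declare tree_size.simps [simp del]

lemma forest_size_eq_0_iff: "forest_size \<tau> = 0 \<longleftrightarrow> \<tau> = []"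
proof (cases \<tau>)
  case (Cons t ts)
  then show ?thesis by (cases t) simp
qed simp

lemma finite_forests_upto [simp]: "finite (forests_upto m :: 'a::finite forest set)"
proof (induction m)
  case 0
  then show ?case by (simp add: forests_upto_def forest_size_eq_0_iff)
next
  case (Suc m)
  have "(forests_upto (Suc m) :: 'a forest set) \<subseteq>
      insert [] ((\<lambda>(i, \<sigma>, \<tau>). Node i \<sigma> # \<tau>) ` (UNIV \<times> forests_upto m \<times> forests_upto m))"
  proof
    fix \<rho> :: "'a forest"
    assume \<rho>: "\<rho> \<in> forests_upto (Suc m)"
    show "\<rho> \<in> insert [] ((\<lambda>(i, \<sigma>, \<tau>). Node i \<sigma> # \<tau>) ` (UNIV \<times> forests_upto m \<times> forests_upto m))"
    proof (cases \<rho>)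
      case (Cons t \<tau>)
      obtain i \<sigma> where t: "t = Node i \<sigma>" by (cases t)
      with Cons \<rho> have "\<sigma> \<in> forests_upto m" "\<tau> \<in> forests_upto m"
        by (auto simp: forests_upto_def)
      with Cons t show ?thesis
        by (auto intro!: image_eqI[where x = "(i, \<sigma>, \<tau>)"])
    qed simp
  qed
  then show ?case
    by (rule finite_subset) (simp add: Suc.IH)
qed


section \<open>The Munthe-Kaas--Wright Hopf algebra\<close>

text \<open>
  The real vector space with basis \<open>B\<close> is the type of finitely supported functions on \<open>B\<close>.
\<close>

type_synonym 'b free_vs = "'b \<Rightarrow>\<^sub>0 real"

abbreviation base :: "'b \<Rightarrow> 'b free_vs" where
  "base b \<equiv> Poly_Mapping.single b 1"

definition lin_ext :: "('b \<Rightarrow> 'c free_vs) \<Rightarrow> 'b free_vs \<Rightarrow> 'c free_vs" where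
  "lin_ext f x = (\<Sum>b\<in>Poly_Mapping.keys x. Poly_Mapping.lookup x b *\<^sub>R f b)"

definition bilin_ext ::
    "('b \<Rightarrow> 'c \<Rightarrow> 'e free_vs) \<Rightarrow> 'b free_vs \<Rightarrow> 'c free_vs \<Rightarrow> 'e free_vs" where
  "bilin_ext f x y = lin_ext (\<lambda>b. lin_ext (f b) y) x"

definition pairing :: "'b free_vs \<Rightarrow> 'b free_vs \<Rightarrow> real" where
  "pairing x y =
    (\<Sum>b\<in>Poly_Mapping.keys x. Poly_Mapping.lookup x b * Poly_Mapping.lookup y b)"

text \<open>The tensor product of the spaces over \<open>B\<close> and \<open>C\<close> is the space over \<open>B \<times> C\<close>.\<close>

definition tensor :: "'b free_vs \<Rightarrow> 'c free_vs \<Rightarrow> ('b \<times> 'c) free_vs" where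
  "tensor = bilin_ext (\<lambda>b c. base (b, c))"

text \<open>
  Shuffles are counted with multiplicity, unlike in the library's set-valued \<^const>\<open>shuffles\<close>.
\<close>

fun shuffle :: "'t list \<Rightarrow> 't list \<Rightarrow> 't list free_vs" where
  "shuffle [] v = base v"
| "shuffle u [] = base u"
| "shuffle (a # u) (b # v) =
     lin_ext (\<lambda>w. base (a # w)) (shuffle u (b # v)) +
     lin_ext (\<lambda>w. base (b # w)) (shuffle (a # u) v)"

text \<open>
  \<open>(\<sigma>\<^sub>1 \<otimes> \<rho>\<^sub>1) \<cdot> (\<sigma>\<^sub>2 \<otimes> \<rho>\<^sub>2)\<close> shuffles the left factors and concatenates the right ones; the recursion
  for the coproduct peels off the rightmost tree of the forest.
\<close>

definition shuffle_concat ::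
    "('t list \<times> 't list) free_vs \<Rightarrow> ('t list \<times> 't list) free_vs \<Rightarrow> ('t list \<times> 't list) free_vs" where
  "shuffle_concat =
    bilin_ext (\<lambda>(\<sigma>1, \<rho>1) (\<sigma>2, \<rho>2). tensor (shuffle \<sigma>1 \<sigma>2) (base (\<rho>1 @ \<rho>2)))"

function coprod :: "'a forest \<Rightarrow> ('a forest \<times> 'a forest) free_vs" where
  "coprod [] = base ([], [])"
| "coprod (\<omega> @ [Node i \<tau>]) =
     base (\<omega> @ [Node i \<tau>], []) +
     shuffle_concat (coprod \<omega>) (lin_ext (\<lambda>(\<sigma>, \<rho>). base (\<sigma>, [Node i \<rho>])) (coprod \<tau>))"
proof -
  fix P and \<rho> :: "'a forest"
  assume "\<rho> = [] \<Longrightarrow> P" and "\<And>\<omega> i \<tau>. \<rho> = \<omega> @ [Node i \<tau>] \<Longrightarrow> P"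
  then show P by (metis ptree.exhaust rev_exhaust)
qed auto
termination
  by (relation "Wellfounded.measure forest_size") auto

text \<open>The product dual to the coproduct, truncated at forests with at most \<open>N\<close> vertices.\<close>

definition star :: "nat \<Rightarrow> 'a::finite forest free_vs \<Rightarrow> 'a forest free_vs \<Rightarrow> 'a forest free_vs" where
  "star N x y =
    (\<Sum>\<tau>\<in>forests_upto N. pairing (tensor x y) (coprod \<tau>) *\<^sub>R base \<tau>)"

lemma pairing_base_star:
  "pairing (base \<tau>) (star N x y) =
    (if forest_size \<tau> \<le> N then pairing (tensor x y) (coprod \<tau>) else 0)"
  by (simp add: pairing_def star_def lookup_sum lookup_single when_def scaleR_poly_mapping_def
      forests_upto_def if_distrib sum.delta finite_forests_upto[unfolded forests_upto_def]
      cong: if_cong)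


section \<open>Planarly branched rough paths and controlled paths\<close>

definition planarly_branched_rough_path ::
    "real \<Rightarrow> real \<Rightarrow> (real \<Rightarrow> real \<Rightarrow> 'a::finite forest free_vs) \<Rightarrow> bool" where
  "planarly_branched_rough_path \<alpha> T X \<longleftrightarrow>
    0 < \<alpha> \<and> \<alpha> \<le> 1 \<and>
    (let N = nat \<lfloor>1 / \<alpha>\<rfloor> in
      (\<forall>s\<in>{0..T}. \<forall>t\<in>{0..T}. Poly_Mapping.keys (X s t) \<subseteq> forests_upto N) \<and>
      (\<forall>s\<in>{0..T}. \<forall>t\<in>{0..T}. pairing (X s t) (base []) = 1) \<and>
      (\<forall>s\<in>{0..T}. \<forall>u\<in>{0..T}. \<forall>t\<in>{0..T}. star N (X s u) (X u t) = X s t) \<and>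
      (\<forall>s\<in>{0..T}. \<forall>t\<in>{0..T}. \<forall>\<sigma> \<tau>. forest_size \<sigma> + forest_size \<tau> \<le> N \<longrightarrow>
        pairing (X s t) (shuffle \<sigma> \<tau>) = pairing (X s t) (base \<sigma>) * pairing (X s t) (base \<tau>)) \<and>
      (\<forall>\<tau>\<in>forests_upto N.
        bdd_above {\<bar>pairing (X s t) (base \<tau>)\<bar> / \<bar>t - s\<bar> powr (real (forest_size \<tau>) * \<alpha>) | s t.
          s \<in> {0..T} \<and> t \<in> {0..T} \<and> s \<noteq> t}))"

definition rough_path_above ::
    "real \<Rightarrow> (real \<Rightarrow> real \<Rightarrow> 'a::finite forest free_vs) \<Rightarrow> (real \<Rightarrow> real ^ 'a) \<Rightarrow> bool" where
  "rough_path_above T X x \<longleftrightarrow>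
    (\<forall>s\<in>{0..T}. \<forall>t\<in>{0..T}. \<forall>i. pairing (X s t) (base (bullet i)) = x t $ i - x s $ i)"

definition pairing_vec :: "'b free_vs \<Rightarrow> 'b free_vs ^ 'n \<Rightarrow> real ^ 'n" where
  "pairing_vec x Y = (\<chi> k. pairing x (Y $ k))"

definition path_in_forests_upto ::
    "real \<Rightarrow> nat \<Rightarrow> (real \<Rightarrow> 'a forest free_vs ^ 'n) \<Rightarrow> bool" where
  "path_in_forests_upto T m Y \<longleftrightarrow>
    (\<forall>t\<in>{0..T}. \<forall>k. Poly_Mapping.keys (Y t $ k) \<subseteq> forests_upto m)"

text \<open>
  Truncating \<open>\<star>\<close> at \<open>N\<close> or at \<open>N - 1\<close> makes no difference below, because \<open>Y s\<close> lives on forests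
  with at most \<open>N - 1\<close> vertices.  The subtractions on \<^typ>\<open>nat\<close> do not truncate when
  \<open>0 < \<alpha> \<le> 1\<close>.  For \<open>s = t\<close> the right-hand side is \<open>0\<close>, as \<open>0 powr a = 0\<close>.
\<close>

definition controlled_above ::
    "real \<Rightarrow> real \<Rightarrow> (real \<Rightarrow> real \<Rightarrow> 'a::finite forest free_vs) \<Rightarrow>
     (real \<Rightarrow> 'a forest free_vs ^ 'n) \<Rightarrow> (real \<Rightarrow> real ^ 'n) \<Rightarrow> bool" where
  "controlled_above \<alpha> T X Y y \<longleftrightarrow>
    (let N = nat \<lfloor>1 / \<alpha>\<rfloor> in
      path_in_forests_upto T (N - 1) Y \<and>
      (\<forall>t\<in>{0..T}. pairing_vec (base []) (Y t) = y t) \<and>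
      (\<forall>\<tau>\<in>forests_upto (N - 1). \<exists>C. \<forall>s\<in>{0..T}. \<forall>t\<in>{0..T}.
        norm (pairing_vec (base \<tau>) (Y t) - pairing_vec (star N (X s t) (base \<tau>)) (Y s))
          \<le> C * \<bar>t - s\<bar> powr (real (N - forest_size \<tau>) * \<alpha>)))"


section \<open>Smooth functions\<close>

definition partial_deriv :: "'d::finite \<Rightarrow> (real ^ 'd \<Rightarrow> real ^ 'n) \<Rightarrow> real ^ 'd \<Rightarrow> real ^ 'n" where
  "partial_deriv i F x = vector_derivative (\<lambda>h. F (x + h *\<^sub>R axis i 1)) (at 0)"

text \<open>
  \<open>C_k k F\<close>: the derivatives of \<open>F\<close> in arbitrary constant directions, iterated up to \<open>k\<close> times,
  exist (as Frechet derivatives) and are continuous on the whole space.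
\<close>

primrec C_k :: "nat \<Rightarrow> ('v::real_normed_vector \<Rightarrow> 'w::real_normed_vector) \<Rightarrow> bool" where
  "C_k 0 F \<longleftrightarrow> continuous_on UNIV F"
| "C_k (Suc k) F \<longleftrightarrow>
     (\<forall>x. F differentiable (at x)) \<and> (\<forall>v. C_k k (\<lambda>x. frechet_derivative F (at x) v))"

definition smooth :: "('v::real_normed_vector \<Rightarrow> 'w::real_normed_vector) \<Rightarrow> bool" where
  "smooth F \<longleftrightarrow> (\<forall>k. C_k k F)"

end

theory Submission
  imports Defs
begin

text \<open>
  Paired with forests of at most one vertex, \<open>\<X>\<^sub>s\<^sub>t \<star> \<one>\<close> has coefficients \<open>1\<close> and \<open>X\<^sup>i\<^sub>t - X\<^sup>i\<^sub>s\<close>, while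
  \<open>\<X>\<^sub>s\<^sub>t \<star> \<bullet>\<^sub>j\<close> is just \<open>\<bullet>\<^sub>j\<close>.  So the remainder at \<open>\<one>\<close> is the second-order Taylor remainder of \<open>F\<close> and
  the remainder at \<open>\<bullet>\<^sub>j\<close> is an increment of \<open>\<partial>\<^sub>j F\<close>.  As \<open>X\<close> is \<open>\<alpha>\<close>-Hoelder, its path stays in a ball, on
  which these are \<open>O(|X\<^sub>t - X\<^sub>s|\<^sup>2)\<close> and \<open>O(|X\<^sub>t - X\<^sub>s|)\<close>.
\<close>

section \<open>Pairings and the truncated product in low degree\<close>

lemma lookup_scaleR [simp]:
  "Poly_Mapping.lookup (c *\<^sub>R x) b = c * Poly_Mapping.lookup x b" for x :: "'b free_vs"
  by (simp add: scaleR_poly_mapping_def)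

lemma lookup_lin_ext:
  "Poly_Mapping.lookup (lin_ext f x) c =
    (\<Sum>b\<in>Poly_Mapping.keys x. Poly_Mapping.lookup x b * Poly_Mapping.lookup (f b) c)"
  by (simp add: lin_ext_def lookup_sum)

lemma lin_ext_base [simp]: "lin_ext f (base b) = f b"
  by (simp add: lin_ext_def)

lemma bilin_ext_base [simp]: "bilin_ext f (base b) (base c) = f b c"
  by (simp add: bilin_ext_def)

lemma lookup_tensor [simp]:
  "Poly_Mapping.lookup (tensor x y) (b, c) = Poly_Mapping.lookup x b * Poly_Mapping.lookup y c"
proof -
  have inner: "Poly_Mapping.lookup (lin_ext (\<lambda>c. base (b', c)) y) (b, c) =
      (if b' = b then Poly_Mapping.lookup y c else 0)" for b'
    by (simp add: lookup_lin_ext lookup_single when_def in_keys_iff if_distrib sum.delta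
        cong: if_cong)
  show ?thesis
    by (simp add: tensor_def bilin_ext_def lookup_lin_ext[of _ x] inner in_keys_iff if_distrib
        sum.delta cong: if_cong)
qed

text \<open>\<open>pairing\<close> sums over the support of its left argument, but below it is the
  right one whose support is known. Outside the intersection of the support of \<open>x\<close> with
  \<open>S\<close> every product vanishes, so the two index sets may be exchanged.\<close>

lemma pairing_eq_sum_right:
  assumes "finite S" and "Poly_Mapping.keys y \<subseteq> S"
  shows "pairing x y = (\<Sum>b\<in>S. Poly_Mapping.lookup x b * Poly_Mapping.lookup y b)"
proof -
  have "pairing x y =
      (\<Sum>b\<in>Poly_Mapping.keys x \<inter> S. Poly_Mapping.lookup x b * Poly_Mapping.lookup y b)"
    unfolding pairing_def using assms
    by (intro sum.mono_neutral_right) (auto simp: in_keys_iff)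
  also have "\<dots> = (\<Sum>b\<in>S. Poly_Mapping.lookup x b * Poly_Mapping.lookup y b)"
    using assms by (intro sum.mono_neutral_left) (auto simp: in_keys_iff)
  finally show ?thesis .
qed

lemma pairing_base_left [simp]: "pairing (base b) y = Poly_Mapping.lookup y b"
  by (simp add: pairing_def)

lemma pairing_base_right [simp]: "pairing x (base b) = Poly_Mapping.lookup x b"
  by (subst pairing_eq_sum_right[of "{b}"]) auto

lemma pairing_add_right: "pairing x (y + z) = pairing x y + pairing x z"
  by (simp add: pairing_def lookup_add algebra_simps sum.distrib)

text \<open>A single vertex is primitive: the recursion is used with both the remaining forest and
  the subtrees empty.\<close>

lemma coprod_bullet: "coprod (bullet i) = base (bullet i, []) + base ([], bullet i)"
  using coprod.simps(2)[of "[]" i "[]"] by (simp add: shuffle_concat_def tensor_def)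

lemma lookup_star_Nil:
  "Poly_Mapping.lookup (star N x y) [] = Poly_Mapping.lookup x [] * Poly_Mapping.lookup y []"
  using pairing_base_star[of "[]" N x y] by simp

text \<open>Dual form of the primitivity of \<open>bullet i\<close>: a Leibniz rule in degree one.
  The bound on \<open>N\<close> keeps \<open>bullet i\<close> from being truncated.\<close>

lemma lookup_star_bullet:
  assumes "1 \<le> N"
  shows "Poly_Mapping.lookup (star N x y) (bullet i) =
    Poly_Mapping.lookup x (bullet i) * Poly_Mapping.lookup y [] +
    Poly_Mapping.lookup x [] * Poly_Mapping.lookup y (bullet i)"
  using pairing_base_star[of "bullet i" N x y] assms
  by (simp add: coprod_bullet pairing_add_right)

lemma forests_upto_1: "forests_upto 1 = insert [] (range bullet)"
proof (intro subset_antisym subsetI)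
  fix \<tau> :: "'a forest"
  assume \<tau>: "\<tau> \<in> forests_upto 1"
  show "\<tau> \<in> insert [] (range bullet)"
  proof (cases \<tau>)
    case (Cons t ts)
    obtain i \<sigma> where "t = Node i \<sigma>" by (cases t)
    with Cons \<tau> show ?thesis by (auto simp: forests_upto_def forest_size_eq_0_iff)
  qed simp
qed (auto simp: forests_upto_def)

text \<open>A controlled path for \<open>N = 2\<close> lives on forests with at most one vertex, so
  of a product \<open>star 2 x y\<close> paired with it only the coefficients at \<open>[]\<close>
  and at the bullets matter.\<close>

lemma pairing_vec_upto_1:
  fixes x :: "'d::finite forest free_vs" and Y :: "'d forest free_vs ^ 'n"
  assumes "\<And>k. Poly_Mapping.keys (Y $ k) \<subseteq> forests_upto 1"
  shows "pairing_vec x Y = Poly_Mapping.lookup x [] *\<^sub>R pairing_vec (base []) Y +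
    (\<Sum>i\<in>UNIV. Poly_Mapping.lookup x (bullet i) *\<^sub>R pairing_vec (base (bullet i)) Y)"
proof -
  have "pairing x (Y $ k) = Poly_Mapping.lookup x [] * Poly_Mapping.lookup (Y $ k) [] +
      (\<Sum>i\<in>UNIV. Poly_Mapping.lookup x (bullet i) * Poly_Mapping.lookup (Y $ k) (bullet i))" for k
    by (subst pairing_eq_sum_right[OF finite_forests_upto assms])
      (subst forests_upto_1, simp add: image_iff sum.reindex inj_def)
  then show ?thesis
    by (simp add: pairing_vec_def vec_eq_iff)
qed


section \<open>Taylor estimates on balls\<close>

text \<open>\<open>C_k 1\<close> gives continuity of the derivative only in each fixed direction.
  Compactness bounds each directional derivative on the ball, summing over a basis bounds the
  operator norm, and the mean value inequality applies because the ball is convex.\<close>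

lemma C_k_1_lipschitz_on_cball:
  fixes G :: "'v::euclidean_space \<Rightarrow> 'w::real_normed_vector"
  assumes "C_k 1 G"
  shows "\<exists>L\<ge>0. \<forall>x\<in>cball a R. \<forall>y\<in>cball a R. norm (G x - G y) \<le> L * norm (x - y)"
proof -
  have diff: "(G has_derivative frechet_derivative G (at x)) (at x)" for x
    using assms by (simp add: frechet_derivative_works)
  have "\<forall>v. \<exists>B. \<forall>x\<in>cball a R. norm (frechet_derivative G (at x) v) \<le> B"
  proof
    fix v :: 'v
    have "continuous_on (cball a R) (\<lambda>x. frechet_derivative G (at x) v)"
      using assms by (auto intro: continuous_on_subset)
    then have "bounded ((\<lambda>x. frechet_derivative G (at x) v) ` cball a R)"
      by (intro compact_imp_bounded compact_continuous_image) auto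
    then show "\<exists>B. \<forall>x\<in>cball a R. norm (frechet_derivative G (at x) v) \<le> B"
      by (simp add: bounded_iff)
  qed
  from choice[OF this]
  obtain B where B: "\<forall>v. \<forall>x\<in>cball a R. norm (frechet_derivative G (at x) v) \<le> B v" ..
  \<comment> \<open>The absolute value yields \<open>0 \<le> L\<close> even when the ball is empty
    and \<open>B\<close> is arbitrary.\<close>
  define L where "L = \<bar>\<Sum>b\<in>Basis. B b\<bar>"
  have "norm (G x - G y) \<le> L * norm (x - y)" if "x \<in> cball a R" "y \<in> cball a R" for x y
  proof (rule differentiable_bound[where S = "cball a R" and f = G
        and f' = "\<lambda>z. frechet_derivative G (at z)"])
    fix z assume z: "z \<in> cball a R"
    show "(G has_derivative frechet_derivative G (at z)) (at z within cball a R)"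
      by (rule has_derivative_at_withinI[OF diff])
    have "onorm (frechet_derivative G (at z)) \<le> (\<Sum>b\<in>Basis. norm (frechet_derivative G (at z) b))"
      by (intro onorm_componentwise has_derivative_bounded_linear[OF diff])
    also have "\<dots> \<le> (\<Sum>b\<in>Basis. B b)"
      by (intro sum_mono B[rule_format] z)
    finally show "onorm (frechet_derivative G (at z)) \<le> L" by (simp add: L_def)
  qed (use that in auto)
  then show ?thesis by (intro exI[of _ L] conjI ballI) (simp_all add: L_def)
qed

text \<open>Each directional derivative is \<open>C_k 1\<close>, hence Lipschitz on the ball.
  Summing over a basis, the derivative moves by at most a multiple of \<open>norm (y - x)\<close> in
  operator norm along the segment, and the linearized mean value inequality supplies the second
  factor.\<close>

lemma C_k_2_taylor_on_cball:
  fixes F :: "'v::euclidean_space \<Rightarrow> 'w::real_normed_vector"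
  assumes "C_k 2 F"
  shows "\<exists>K. \<forall>x\<in>cball a R. \<forall>y\<in>cball a R.
    norm (F y - F x - frechet_derivative F (at x) (y - x)) \<le> K * (norm (y - x))\<^sup>2"
proof -
  have diff: "(F has_derivative frechet_derivative F (at x)) (at x)" for x
    using assms by (simp add: numeral_2_eq_2 frechet_derivative_works)
  have "\<forall>v. \<exists>L\<ge>0. \<forall>x\<in>cball a R. \<forall>y\<in>cball a R.
      norm (frechet_derivative F (at x) v - frechet_derivative F (at y) v) \<le> L * norm (x - y)"
  proof
    fix v :: 'v
    have "C_k 1 (\<lambda>x. frechet_derivative F (at x) v)"
      using assms by (simp add: numeral_2_eq_2)
    then show "\<exists>L\<ge>0. \<forall>x\<in>cball a R. \<forall>y\<in>cball a R.
        norm (frechet_derivative F (at x) v - frechet_derivative F (at y) v) \<le> L * norm (x - y)"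
      by (rule C_k_1_lipschitz_on_cball)
  qed
  from choice[OF this]
  obtain L where L: "\<forall>v. 0 \<le> L v \<and> (\<forall>x\<in>cball a R. \<forall>y\<in>cball a R.
      norm (frechet_derivative F (at x) v - frechet_derivative F (at y) v) \<le> L v * norm (x - y))" ..
  define K where "K = (\<Sum>b\<in>Basis. L b)"
  have "norm (F y - F x - frechet_derivative F (at x) (y - x)) \<le> K * (norm (y - x))\<^sup>2"
    if xy: "x \<in> cball a R" "y \<in> cball a R" for x y
  proof -
    \<comment> \<open>On the segment, unlike on the whole ball,
      \<open>norm (z - x) \<le> norm (y - x)\<close>; this makes the bound quadratic.\<close>
    let ?S = "closed_segment x y"
    have "norm (F y - F x - frechet_derivative F (at x) (y - x)) \<le> norm (y - x) * (K * norm (y - x))"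
    proof (rule differentiable_bound_linearization[where S = ?S and f = F
          and f' = "\<lambda>z. frechet_derivative F (at z)"])
      show "x + t *\<^sub>R (y - x) \<in> ?S" if "t \<in> {0..1}" for t
        using that unfolding closed_segment_def by (auto simp: algebra_simps intro!: exI[of _ t])
      show "(F has_derivative frechet_derivative F (at z)) (at z within ?S)" for z
        by (rule has_derivative_at_withinI[OF diff])
      fix z assume z: "z \<in> ?S"
      have zR: "z \<in> cball a R"
        using z xy closed_segment_subset[OF xy convex_cball] by auto
      have lin: "bounded_linear (\<lambda>v. frechet_derivative F (at z) v - frechet_derivative F (at x) v)"
        by (intro bounded_linear_sub has_derivative_bounded_linear[OF diff])
      have "onorm (\<lambda>v. frechet_derivative F (at z) v - frechet_derivative F (at x) v) \<le>
          (\<Sum>b\<in>Basis. norm (frechet_derivative F (at z) b - frechet_derivative F (at x) b))"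
        by (rule onorm_componentwise[OF lin])
      also have "\<dots> \<le> (\<Sum>b\<in>Basis. L b * norm (y - x))"
      proof (rule sum_mono)
        fix b :: 'v
        have "norm (frechet_derivative F (at z) b - frechet_derivative F (at x) b) \<le> L b * norm (z - x)"
          using L zR xy(1) by blast
        also have "\<dots> \<le> L b * norm (y - x)"
          using z L by (intro mult_left_mono) (auto dest: segment_bound1 simp: norm_minus_commute)
        finally show "norm (frechet_derivative F (at z) b - frechet_derivative F (at x) b) \<le>
            L b * norm (y - x)" .
      qed
      finally show "onorm (frechet_derivative F (at z) - frechet_derivative F (at x)) \<le>
          K * norm (y - x)"
        by (simp add: K_def sum_distrib_right fun_diff_def)
    qed auto
    then show ?thesis by (simp add: power2_eq_square algebra_simps)
  qed
  then show ?thesis by (intro exI[of _ K] ballI)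
qed

lemma partial_deriv_eq_frechet_derivative:
  assumes "F differentiable (at x)"
  shows "partial_deriv i F x = frechet_derivative F (at x) (axis i 1)"
proof -
  \<comment> \<open>The base point is written as the value at \<open>h = 0\<close> of the line
    through \<open>x\<close>, the form the chain rule expects.\<close>
  have "(F has_derivative frechet_derivative F (at x)) (at (x + 0 *\<^sub>R axis i 1))"
    using assms by (simp add: frechet_derivative_works)
  moreover have "((\<lambda>h. x + h *\<^sub>R axis i 1) has_derivative (\<lambda>h. h *\<^sub>R axis i 1)) (at 0)"
    by (auto intro!: derivative_eq_intros)
  ultimately have "((\<lambda>h. F (x + h *\<^sub>R axis i 1)) has_derivative
      (\<lambda>h. frechet_derivative F (at x) (h *\<^sub>R axis i 1))) (at 0)"
    by (rule has_derivative_compose[rotated])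
  then have "((\<lambda>h. F (x + h *\<^sub>R axis i 1)) has_vector_derivative
      frechet_derivative F (at x) (axis i 1)) (at 0)"
    using linear_frechet_derivative[OF assms]
    by (simp add: has_vector_derivative_def linear_scale)
  then show ?thesis
    unfolding partial_deriv_def by (rule vector_derivative_at)
qed

text \<open>Identifies the linear Taylor term with the sum over bullets that arises from pairing
  with \<open>Z\<close>.\<close>

lemma frechet_derivative_eq_sum_partial_deriv:
  assumes "F differentiable (at x)"
  shows "frechet_derivative F (at x) v = (\<Sum>i\<in>UNIV. v $ i *\<^sub>R partial_deriv i F x)"
proof -
  have "v = (\<Sum>i\<in>UNIV. v $ i *\<^sub>R axis i 1)"
    using basis_expansion[of v] by (simp add: scalar_mult_eq_scaleR)
  then have "frechet_derivative F (at x) v =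
      frechet_derivative F (at x) (\<Sum>i\<in>UNIV. v $ i *\<^sub>R axis i 1)"
    by (rule arg_cong)
  also have "\<dots> = (\<Sum>i\<in>UNIV. v $ i *\<^sub>R frechet_derivative F (at x) (axis i 1))"
    using linear_frechet_derivative[OF assms] by (simp add: linear_sum linear_scale)
  finally show ?thesis
    by (simp add: partial_deriv_eq_frechet_derivative[OF assms])
qed


section \<open>Composition with a smooth function\<close>

text \<open>A bullet has one vertex, so the analytic bound on its coefficient is the Hoelder bound
  for one coordinate of \<open>X\<close>; since \<alpha> \<le> 1, bullets survive the
  truncation.\<close>

lemma rough_path_above_hoelder:
  fixes \<X> :: "real \<Rightarrow> real \<Rightarrow> 'd::finite forest free_vs"
  assumes rp: "planarly_branched_rough_path \<alpha> T \<X>" and above: "rough_path_above T \<X> X"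
  obtains H where "0 \<le> H" and "\<And>s t. s \<in> {0..T} \<Longrightarrow> t \<in> {0..T} \<Longrightarrow>
    norm (X t - X s) \<le> H * \<bar>t - s\<bar> powr \<alpha>"
proof -
  have \<alpha>: "0 < \<alpha>" "\<alpha> \<le> 1"
    using rp by (auto simp: planarly_branched_rough_path_def)
  then have "1 \<le> nat \<lfloor>1 / \<alpha>\<rfloor>" by (simp add: le_nat_iff le_floor_iff)
  have "\<forall>i. \<exists>H. \<forall>s\<in>{0..T}. \<forall>t\<in>{0..T}. \<bar>X t $ i - X s $ i\<bar> \<le> H * \<bar>t - s\<bar> powr \<alpha>"
  proof
    fix i :: 'd
    have "bullet i \<in> forests_upto (nat \<lfloor>1 / \<alpha>\<rfloor>)"
      using \<open>1 \<le> nat \<lfloor>1 / \<alpha>\<rfloor>\<close> by (simp add: forests_upto_def)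
    then have "bdd_above {\<bar>pairing (\<X> s t) (base (bullet i))\<bar> /
        \<bar>t - s\<bar> powr (real (forest_size (bullet i)) * \<alpha>) | s t.
        s \<in> {0..T} \<and> t \<in> {0..T} \<and> s \<noteq> t}"
      using rp unfolding planarly_branched_rough_path_def Let_def
      by (elim conjE) (rule bspec, assumption+)
    then obtain H where "\<And>s t. s \<in> {0..T} \<Longrightarrow> t \<in> {0..T} \<Longrightarrow> s \<noteq> t \<Longrightarrow>
        \<bar>pairing (\<X> s t) (base (bullet i))\<bar> / \<bar>t - s\<bar> powr (real (forest_size (bullet i)) * \<alpha>) \<le> H"
      unfolding bdd_above_def by blast
    then have H: "\<bar>X t $ i - X s $ i\<bar> / \<bar>t - s\<bar> powr \<alpha> \<le> H"
      if "s \<in> {0..T}" "t \<in> {0..T}" "s \<noteq> t" for s t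
      using above that by (simp add: rough_path_above_def)
    \<comment> \<open>The supremum excludes \<open>s = t\<close>; there both sides are zero, as
      \<open>0 powr \<alpha> = 0\<close>.\<close>
    have "\<bar>X t $ i - X s $ i\<bar> \<le> H * \<bar>t - s\<bar> powr \<alpha>" if "s \<in> {0..T}" "t \<in> {0..T}" for s t
      using H[OF that] by (cases "s = t") (auto simp: divide_simps)
    then show "\<exists>H. \<forall>s\<in>{0..T}. \<forall>t\<in>{0..T}. \<bar>X t $ i - X s $ i\<bar> \<le> H * \<bar>t - s\<bar> powr \<alpha>"
      by blast
  qed
  from choice[OF this]
  obtain H where H: "\<forall>i. \<forall>s\<in>{0..T}. \<forall>t\<in>{0..T}.
      \<bar>X t $ i - X s $ i\<bar> \<le> H i * \<bar>t - s\<bar> powr \<alpha>" ..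
  have "norm (X t - X s) \<le> \<bar>\<Sum>i\<in>UNIV. H i\<bar> * \<bar>t - s\<bar> powr \<alpha>" if "s \<in> {0..T}" "t \<in> {0..T}" for s t
  proof -
    have "norm (X t - X s) \<le> (\<Sum>i\<in>UNIV. \<bar>X t $ i - X s $ i\<bar>)"
      using norm_le_l1_cart[of "X t - X s"] by simp
    also have "\<dots> \<le> (\<Sum>i\<in>UNIV. H i * \<bar>t - s\<bar> powr \<alpha>)"
      by (intro sum_mono H[rule_format] that)
    also have "\<dots> \<le> \<bar>\<Sum>i\<in>UNIV. H i\<bar> * \<bar>t - s\<bar> powr \<alpha>"
      by (simp add: sum_distrib_right[symmetric] mult_right_mono)
    finally show ?thesis .
  qed
  then show ?thesis by (intro that[of "\<bar>\<Sum>i\<in>UNIV. H i\<bar>"]) auto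
qed

theorem proposition2p10:
  fixes \<alpha> T :: real
    and \<X> :: "real \<Rightarrow> real \<Rightarrow> 'd::finite forest free_vs"
    and X :: "real \<Rightarrow> real ^ 'd"
    and F :: "real ^ 'd \<Rightarrow> real ^ 'n"
    and Z :: "real \<Rightarrow> 'd forest free_vs ^ 'n"
  assumes "0 < T"
    and "1 / 3 < \<alpha>" and "\<alpha> \<le> 1 / 2"
    and "planarly_branched_rough_path \<alpha> T \<X>"
    and "rough_path_above T \<X> X"
    and "smooth F"
    and "path_in_forests_upto T 1 Z"
    and "\<And>t. t \<in> {0..T} \<Longrightarrow> pairing_vec (base []) (Z t) = F (X t)"
    and "\<And>t i. t \<in> {0..T} \<Longrightarrow> pairing_vec (base (bullet i)) (Z t) = partial_deriv i F (X t)"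
  shows "controlled_above \<alpha> T \<X> Z (\<lambda>t. F (X t))"
proof -
  have "\<lfloor>1 / \<alpha>\<rfloor> = 2"
    using assms(2,3) by (auto simp: floor_eq_iff field_simps)
  then have N: "nat \<lfloor>1 / \<alpha>\<rfloor> = 2" by simp
  obtain H where H0: "0 \<le> H" and H: "\<And>s t. s \<in> {0..T} \<Longrightarrow> t \<in> {0..T} \<Longrightarrow>
      norm (X t - X s) \<le> H * \<bar>t - s\<bar> powr \<alpha>"
    using rough_path_above_hoelder[OF assms(4,5)] by blast
  \<comment> \<open>The Hoelder bound over the longest possible time step, measured from time
    \<open>0\<close>.\<close>
  define R where "R = H * T powr \<alpha>"
  have XR: "X t \<in> cball (X 0) R" if "t \<in> {0..T}" for t
  proof -
    have "norm (X t - X 0) \<le> H * \<bar>t - 0\<bar> powr \<alpha>"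
      using that assms(1) by (intro H) auto
    also have "\<dots> \<le> R"
      unfolding R_def using that assms(2) H0 by (intro mult_left_mono powr_mono2) auto
    finally show ?thesis by (simp add: dist_norm norm_minus_commute)
  qed
  have C2: "C_k 2 F" using assms(6) by (simp add: smooth_def)
  then have diff: "F differentiable (at x)" for x
    by (simp add: numeral_2_eq_2)
  have unit: "Poly_Mapping.lookup (\<X> s t) [] = 1" if "s \<in> {0..T}" "t \<in> {0..T}" for s t
  proof -
    have "pairing (\<X> s t) (base []) = 1"
      using assms(4) that unfolding planarly_branched_rough_path_def Let_def by blast
    then show ?thesis by simp
  qed
  have incr: "Poly_Mapping.lookup (\<X> s t) (bullet i) = X t $ i - X s $ i"
    if "s \<in> {0..T}" "t \<in> {0..T}" for s t i
    using assms(5) that by (simp add: rough_path_above_def)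
  have expand: "pairing_vec x (Z s) = Poly_Mapping.lookup x [] *\<^sub>R F (X s) +
      (\<Sum>i\<in>UNIV. Poly_Mapping.lookup x (bullet i) *\<^sub>R partial_deriv i F (X s))"
    if "s \<in> {0..T}" for x s
    using pairing_vec_upto_1[of "Z s" x] assms(7-9) that by (simp add: path_in_forests_upto_def)
  have "\<exists>C. \<forall>s\<in>{0..T}. \<forall>t\<in>{0..T}.
      norm (pairing_vec (base \<tau>) (Z t) - pairing_vec (star 2 (\<X> s t) (base \<tau>)) (Z s))
        \<le> C * \<bar>t - s\<bar> powr (real (2 - forest_size \<tau>) * \<alpha>)"
    if "\<tau> \<in> forests_upto 1" for \<tau>
  proof -
    from that consider "\<tau> = []" | j where "\<tau> = bullet j"
      unfolding forests_upto_1 by blast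
    then show ?thesis
    proof cases
      case 1
      obtain K where K: "\<forall>x\<in>cball (X 0) R. \<forall>y\<in>cball (X 0) R.
          norm (F y - F x - frechet_derivative F (at x) (y - x)) \<le> K * (norm (y - x))\<^sup>2"
        using C_k_2_taylor_on_cball[OF C2] ..
      have "norm (pairing_vec (base \<tau>) (Z t) - pairing_vec (star 2 (\<X> s t) (base \<tau>)) (Z s))
          \<le> \<bar>K\<bar> * H\<^sup>2 * \<bar>t - s\<bar> powr (real (2 - forest_size \<tau>) * \<alpha>)" if st: "s \<in> {0..T}" "t \<in> {0..T}" for s t
      proof -
        \<comment> \<open>The coefficients \<open>1\<close> and \<open>X t $ i - X s $ i\<close>
          turn the expansion into the first-order Taylor polynomial of \<open>F\<close> at
          \<open>X s\<close>.\<close>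
        have "pairing_vec (star 2 (\<X> s t) (base \<tau>)) (Z s) =
            F (X s) + frechet_derivative F (at (X s)) (X t - X s)"
          by (simp add: 1 expand[OF st(1)] lookup_star_Nil lookup_star_bullet unit[OF st] incr[OF st]
              frechet_derivative_eq_sum_partial_deriv[OF diff] lookup_single)
        then have "norm (pairing_vec (base \<tau>) (Z t) -
            pairing_vec (star 2 (\<X> s t) (base \<tau>)) (Z s)) =
            norm (F (X t) - F (X s) - frechet_derivative F (at (X s)) (X t - X s))"
          by (simp add: 1 assms(8)[OF st(2)] diff_diff_eq)
        also have "\<dots> \<le> K * (norm (X t - X s))\<^sup>2"
          by (intro K[rule_format] XR st)
        \<comment> \<open>The sign of \<open>K\<close> is unknown, and the next estimate needs a
          nonnegative factor.\<close>
        also have "\<dots> \<le> \<bar>K\<bar> * (norm (X t - X s))\<^sup>2"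
          by (simp add: mult_right_mono)
        also have "\<dots> \<le> \<bar>K\<bar> * (H * \<bar>t - s\<bar> powr \<alpha>)\<^sup>2"
          by (intro mult_left_mono power_mono H st) auto
        also have "\<dots> = \<bar>K\<bar> * H\<^sup>2 * \<bar>t - s\<bar> powr (real (2 - forest_size \<tau>) * \<alpha>)"
          by (simp add: 1 power2_eq_square powr_add[symmetric])
        finally show ?thesis .
      qed
      then show ?thesis by blast
    next
      case (2 j)
      \<comment> \<open>The required exponent is now only \<alpha>, so a Lipschitz bound on the
        partial derivative suffices.\<close>
      have "C_k 1 (partial_deriv j F)"
        using C2 by (simp add: numeral_2_eq_2 partial_deriv_eq_frechet_derivative[OF diff, abs_def])
      then obtain L where L0: "0 \<le> L" and L: "\<forall>x\<in>cball (X 0) R. \<forall>y\<in>cball (X 0) R.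
          norm (partial_deriv j F x - partial_deriv j F y) \<le> L * norm (x - y)"
        using C_k_1_lipschitz_on_cball[where a = "X 0" and R = R] by blast
      have "norm (pairing_vec (base \<tau>) (Z t) - pairing_vec (star 2 (\<X> s t) (base \<tau>)) (Z s))
          \<le> L * H * \<bar>t - s\<bar> powr (real (2 - forest_size \<tau>) * \<alpha>)" if st: "s \<in> {0..T}" "t \<in> {0..T}" for s t
      proof -
        \<comment> \<open>\<open>base (bullet j)\<close> has coefficient \<open>0\<close> at
          \<open>[]\<close>, which removes the increments of \<open>X\<close>; the unit coefficient
          of \<open>\<X> s t\<close> leaves only the term with \<open>i = j\<close>.\<close>
        have "pairing_vec (star 2 (\<X> s t) (base \<tau>)) (Z s) = partial_deriv j F (X s)"
          by (simp add: 2 expand[OF st(1)] lookup_star_Nil lookup_star_bullet unit[OF st] lookup_single when_def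
              if_distrib[of "\<lambda>c. c *\<^sub>R _"] cong: if_cong)
        then have "norm (pairing_vec (base \<tau>) (Z t) -
            pairing_vec (star 2 (\<X> s t) (base \<tau>)) (Z s)) =
            norm (partial_deriv j F (X t) - partial_deriv j F (X s))"
          by (simp add: 2 assms(9)[OF st(2)])
        also have "\<dots> \<le> L * norm (X t - X s)"
          by (intro L[rule_format] XR st)
        also have "\<dots> \<le> L * (H * \<bar>t - s\<bar> powr \<alpha>)"
          by (intro mult_left_mono H st L0)
        finally show ?thesis by (simp add: 2)
      qed
      then show ?thesis by blast
    qed
  qed
  then show ?thesis
    unfolding controlled_above_def N Let_def using assms(7,8) by simp
qed

end
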